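(* Let $D$ be an integral domain that is not a field, with quotient field $K$, let $L$ be an extension field of $K$, let $X$ be an indeterminate over $L$, and let $P$ be a predicate (property) on ideals of integral domains. A. Suppose that $P$ respects principals, and let $R=D+XL[X]$. (i) If, for every maximal ideal $M$ of $D$, $P$ holds for $M$ if and only if $P$ holds for the ideal $M+XL[X]$ of $R$, then $I(D)\vartriangleleft P \Leftrightarrow I(R)\vartriangleleft P$. (ii) If, for every maximal $t$-ideal $M$ of $D$, $P$ holds for $M$ if and only if $P$ holds for the ideal $M+XL[X]$ of $R$, then $I_t(D)\vartriangleleft P \Leftrightarrow I_t(R)\vartriangleleft P$. B. Let $R=D+XL[[X]]$ (here $P$ is not required to respect principals). (iii) If, for every maximal ideal $M$ of $D$, $P$ holds for $M$ if and only if $P$ holds for the ideal $M+XL[[X]]$ of $R$, then $I(D)\vartriangleleft P \Leftrightarrow I(R)\vartriangleleft P$. (iv) If, for every maximal $t$-ideal $M$ of $D$, $P$ holds for $M$ if and only if $P$ holds for the ideal $M+XL[[X]]$ of $R$, then $I_t(D)\vartriangleleft P \Leftrightarrow I_t(R)\vartriangleleft P$.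
   Context: For an integral domain $A$ with quotient field $F$ and a nonzero fractional ideal $I$ of $A$: $I^{-1}=\{x\in F: xI\subseteq A\}$, $I_v=(I^{-1})^{-1}$, and $I_t=\bigcup\{J_v: J\subseteq I \text{ a nonzero finitely generated ideal}\}$. $I$ is a $t$-ideal if $I=I_t$. A maximal $t$-ideal is an ideal maximal among proper integral $t$-ideals of $A$. $I(A)$ is the set of nonzero proper integral ideals of $A$, and $I_t(A)$ is the set of (nonzero) proper integral $t$-ideals of $A$. For $S(A)=I(A)$ or $I_t(A)$ and a property $P$ of ideals, $\Gamma_{S(A)}(P)$ is the set of members of $S(A)$ satisfying $P$, and $S(A)\vartriangleleft P$ ("$S(A)$ meets $P$") means that for every $s\in S(A)$ there is $\gamma\in\Gamma_{S(A)}(P)$ with $s\subseteq\gamma$. $P$ respects principals if $P$ holds for principal ideals. $D+XL[X]=\{f\in L[X]: f(0)\in D\}$ and $D+XL[[X]]=\{f\in L[[X]]: f(0)\in D\}$. *)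

theory Defs
  imports
    "HOL-Algebra.Ideal"
    "HOL-Computational_Algebra.Formal_Laurent_Series"
    "HOL-Computational_Algebra.Polynomial_FPS"
begin

text \<open>
  Integral domains are represented as subrings of an ambient field type, with the
  quotient field formed inside that type.
\<close>

definition ring_on :: "'f::field set \<Rightarrow> 'f ring" where
  "ring_on A = \<lparr>carrier = A, monoid.mult = (*), one = 1, zero = 0, add = (+)\<rparr>"

definition quotient_field :: "'f::field set \<Rightarrow> 'f set" where
  "quotient_field A = {a / b |a b. a \<in> A \<and> b \<in> A \<and> b \<noteq> 0}"

definition fractional_ideal :: "'f::field set \<Rightarrow> 'f set \<Rightarrow> bool" where
  "fractional_ideal A I \<longleftrightarrow>
     I \<subseteq> quotient_field A \<and> (\<exists>d\<in>A. d \<noteq> 0 \<and> ideal ((*) d ` I) (ring_on A))"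

definition fin_gen :: "'f::field set \<Rightarrow> 'f set \<Rightarrow> bool" where
  "fin_gen A J \<longleftrightarrow> (\<exists>S. finite S \<and> J = {\<Sum>s\<in>S. c s * s |c. \<forall>s\<in>S. c s \<in> A})"

definition inverse_ideal :: "'f::field set \<Rightarrow> 'f set \<Rightarrow> 'f set" where
  "inverse_ideal A I = {x \<in> quotient_field A. \<forall>y\<in>I. x * y \<in> A}"

definition v_closure :: "'f::field set \<Rightarrow> 'f set \<Rightarrow> 'f set" where
  "v_closure A I = inverse_ideal A (inverse_ideal A I)"

definition t_closure :: "'f::field set \<Rightarrow> 'f set \<Rightarrow> 'f set" where
  "t_closure A I =
     \<Union>{v_closure A J |J. J \<subseteq> I \<and> fractional_ideal A J \<and> J \<noteq> {0} \<and> fin_gen A J}"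

definition t_ideal :: "'f::field set \<Rightarrow> 'f set \<Rightarrow> bool" where
  "t_ideal A I \<longleftrightarrow> fractional_ideal A I \<and> I \<noteq> {0} \<and> I = t_closure A I"

text \<open>The families $I(A)$ and $I_t(A)$.\<close>

definition integral_ideals :: "'f::field set \<Rightarrow> 'f set set" where
  "integral_ideals A = {I. ideal I (ring_on A) \<and> I \<noteq> {0} \<and> I \<noteq> A}"

definition integral_t_ideals :: "'f::field set \<Rightarrow> 'f set set" where
  "integral_t_ideals A = {I \<in> integral_ideals A. t_ideal A I}"

definition maximal_t_ideal :: "'f::field set \<Rightarrow> 'f set \<Rightarrow> bool" where
  "maximal_t_ideal A M \<longleftrightarrow>
     M \<in> integral_t_ideals A \<and> (\<forall>I\<in>integral_t_ideals A. M \<subseteq> I \<longrightarrow> I = M)"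

text \<open>
  A property of ideals takes the ring and the ideal. The family \<open>S\<close> below is
  \<open>integral_ideals\<close> or \<open>integral_t_ideals\<close>.
\<close>

definition Gamma ::
  "('f::field set \<Rightarrow> 'f set set) \<Rightarrow> 'f set \<Rightarrow> ('f ring \<Rightarrow> 'f set \<Rightarrow> bool) \<Rightarrow> 'f set set" where
  "Gamma S A P = {I \<in> S A. P (ring_on A) I}"

definition meets ::
  "('f::field set \<Rightarrow> 'f set set) \<Rightarrow> 'f set \<Rightarrow> ('f ring \<Rightarrow> 'f set \<Rightarrow> bool) \<Rightarrow> bool" where
  "meets S A P \<longleftrightarrow> (\<forall>s\<in>S A. \<exists>\<gamma>\<in>Gamma S A P. s \<subseteq> \<gamma>)"

text \<open>
  Only nonzero principal ideals are required to satisfy \<open>P\<close>, so that properties such as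
  invertibility respect principals. The zero ideal belongs to neither $I(A)$ nor $I_t(A)$.
\<close>

definition respects_principals :: "('f ring \<Rightarrow> 'f set \<Rightarrow> bool) \<Rightarrow> bool" where
  "respects_principals P \<longleftrightarrow>
     (\<forall>A I. domain A \<longrightarrow> principalideal I A \<longrightarrow> I \<noteq> {\<zero>\<^bsub>A\<^esub>} \<longrightarrow> P A I)"

text \<open>
  The field $L$ is the type \<open>'l\<close>, identified with the constants of $L((X))$, the type
  \<open>'l fls\<close>. Both $L[X]$ and $L[[X]]$ embed there, so $D$, $D + XL[X]$ and $D + XL[[X]]$
  are subrings of one field and a single predicate on ideals applies to all of them.
  The two constructions below are applied to $D$ and to its ideals $M$ alike.
\<close>

definition constants :: "'l::field fls set" where
  "constants = range fls_const"

definition plus_X_poly :: "'l::field fls set \<Rightarrow> 'l fls set" where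
  "plus_X_poly D = {fps_to_fls (fps_of_poly f) |f. fls_const (poly f 0) \<in> D}"

definition plus_X_fps :: "'l::field fls set \<Rightarrow> 'l fls set" where
  "plus_X_fps D = {fps_to_fls f |f. fls_const (fps_nth f 0) \<in> D}"

end

theory Submission
  imports Defs
begin

text \<open>
  Let $B$ be $L[X]$ or $L[[X]]$ and $R = D + XB$. Extension $M \mapsto M + XB$ maps the nonzero
  proper ideals of $D$ to ideals of $R$, detects $t$-ideals, and reaches every ideal of $R$ that
  contains some $M + XB$; so maximal members of $S(D)$ go to maximal members of $S(R)$. Let
  $N \in S(R)$ and let $I$ be its ideal of constant terms. If $I$ (or $I_t$, in the $t$-case) is
  proper, then $N$ lies in $M + XB$ for a maximal $M \in S(D)$. Otherwise $N$ cannot generate the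
  unit ideal of $B$, since this would force $1 \in N$ (in the $t$-case through a finite
  $F \subseteq N$ with $F^{-1} = R$). For $L[[X]]$ this is absurd, as $N$ contains a unit of $B$.
  For $L[X]$ the generator $g$ of $N L[X]$ with $g(0) = 1$ is then not constant, and $N$ lies in
  the proper principal ideal $gR$.
\<close>

section \<open>Subrings of a field and their ideals\<close>

locale field_subring =
  fixes A :: "'f::field set"
  assumes zero_mem: "0 \<in> A"
    and one_mem: "1 \<in> A"
    and add_mem: "x \<in> A \<Longrightarrow> y \<in> A \<Longrightarrow> x + y \<in> A"
    and uminus_mem: "x \<in> A \<Longrightarrow> - x \<in> A"
    and mult_mem: "x \<in> A \<Longrightarrow> y \<in> A \<Longrightarrow> x * y \<in> A"
begin

lemma diff_mem: "x \<in> A \<Longrightarrow> y \<in> A \<Longrightarrow> x - y \<in> A"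
  using add_mem[of x "- y"] uminus_mem by simp

lemma sum_mem: "(\<And>s. s \<in> S \<Longrightarrow> f s \<in> A) \<Longrightarrow> sum f S \<in> A"
  by (induction S rule: infinite_finite_induct) (auto intro: zero_mem add_mem)

lemma domain_ring_on: "domain (ring_on A)"
proof -
  have "\<exists>y\<in>A. y + x = 0" if "x \<in> A" for x
    using uminus_mem[OF that] by (intro bexI[of _ "- x"]) auto
  then have "cring (ring_on A)"
    by (intro cringI abelian_groupI comm_monoidI)
      (auto simp: ring_on_def algebra_simps zero_mem one_mem intro: add_mem mult_mem)
  then show ?thesis
    by (intro domain.intro domain_axioms.intro) (auto simp: ring_on_def)
qed

text \<open>Closure under negatives follows from the multiplication clause, because
  \<open>- x\<close> equals \<open>- 1 * x\<close> and \<open>- 1\<close> lies in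
  \<open>A\<close>.\<close>

lemma ideal_iff:
  "ideal I (ring_on A) \<longleftrightarrow>
     I \<subseteq> A \<and> 0 \<in> I \<and> (\<forall>x\<in>I. \<forall>y\<in>I. x + y \<in> I) \<and> (\<forall>a\<in>A. \<forall>x\<in>I. a * x \<in> I)"
    (is "_ \<longleftrightarrow> ?R")
proof
  assume "ideal I (ring_on A)"
  then interpret ideal I "ring_on A" .
  show ?R
    using a_subset additive_subgroup.zero_closed[OF is_additive_subgroup]
      additive_subgroup.a_closed[OF is_additive_subgroup] I_l_closed
    by (auto simp: ring_on_def)
next
  assume *: ?R
  interpret domain "ring_on A" by (rule domain_ring_on)
  have inv: "\<ominus>\<^bsub>ring_on A\<^esub> x = - x" if "x \<in> A" for x
    using that uminus_mem[OF that] by (intro minus_equality) (auto simp: ring_on_def)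
  show "ideal I (ring_on A)"
  proof (rule idealI)
    have "- x \<in> I" if "x \<in> I" for x
    proof -
      have "- 1 * x \<in> I" using * that one_mem uminus_mem by blast
      then show ?thesis by simp
    qed
    then have "\<ominus>\<^bsub>ring_on A\<^esub> x \<in> I" if "x \<in> I" for x
      using * that inv[of x] by auto
    then show "subgroup I (add_monoid (ring_on A))"
      using * by (intro subgroup.intro) (auto simp: a_inv_def ring_on_def)
    show "ring (ring_on A)" by (rule ring_axioms)
    show "x \<otimes>\<^bsub>ring_on A\<^esub> a \<in> I" "a \<otimes>\<^bsub>ring_on A\<^esub> x \<in> I"
      if "a \<in> I" "x \<in> carrier (ring_on A)" for a x
    proof -
      have "x * a \<in> I" using that * by (simp add: ring_on_def)
      then show "x \<otimes>\<^bsub>ring_on A\<^esub> a \<in> I" "a \<otimes>\<^bsub>ring_on A\<^esub> x \<in> I"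
        by (simp_all add: ring_on_def mult.commute[of a x])
    qed
  qed
qed

section \<open>Inverses and the v-closure of a set\<close>

lemma quotient_field_iff: "x \<in> quotient_field A \<longleftrightarrow> (\<exists>a\<in>A. \<exists>b\<in>A. b \<noteq> 0 \<and> x = a / b)"
  by (auto simp: quotient_field_def)

lemma subset_quotient_field: "A \<subseteq> quotient_field A"
  using one_mem by (force simp: quotient_field_def)

lemma inverse_ideal_1: "S \<subseteq> A \<Longrightarrow> 1 \<in> inverse_ideal A S"
  using one_mem subset_quotient_field by (auto simp: inverse_ideal_def)

lemma v_closure_subset: "S \<subseteq> A \<Longrightarrow> v_closure A S \<subseteq> A"
  using inverse_ideal_1[of S] by (force simp: v_closure_def inverse_ideal_def)

text \<open>As \<open>S\<close> lies in \<open>A\<close>, its inverse contains 1, and multiplying by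
  1 already forces \<open>S_v\<close> into \<open>A\<close>. This trades the quotient field
  condition of the outer inverse for plain membership in \<open>A\<close>.\<close>

lemma v_closure_iff:
  assumes "S \<subseteq> A"
  shows "x \<in> v_closure A S \<longleftrightarrow> x \<in> A \<and> (\<forall>z\<in>inverse_ideal A S. x * z \<in> A)"
  using v_closure_subset[OF assms] subset_quotient_field
  unfolding v_closure_def inverse_ideal_def[of A "inverse_ideal A S"] by blast

lemma inverse_ideal_antimono: "S \<subseteq> T \<Longrightarrow> inverse_ideal A T \<subseteq> inverse_ideal A S"
  by (auto simp: inverse_ideal_def)

lemma v_closure_mono: "S \<subseteq> T \<Longrightarrow> v_closure A S \<subseteq> v_closure A T"
  unfolding v_closure_def by (intro inverse_ideal_antimono)

lemma subset_v_closure: "S \<subseteq> A \<Longrightarrow> S \<subseteq> v_closure A S"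
  using subset_quotient_field by (auto simp: v_closure_def inverse_ideal_def mult.commute)

text \<open>The inverse of \<open>S\<close> multiplies \<open>S_v\<close>, hence also
  \<open>T\<close>, into \<open>A\<close>, so it is contained in the inverse of \<open>T\<close>.
  Taking inverses once more reverses this inclusion.\<close>

lemma v_closure_least:
  assumes "T \<subseteq> v_closure A S" shows "v_closure A T \<subseteq> v_closure A S"
proof -
  have "x * y \<in> A" if "x \<in> inverse_ideal A S" "y \<in> T" for x y
  proof -
    have "y \<in> inverse_ideal A (inverse_ideal A S)"
      using that assms by (auto simp: v_closure_def)
    then show ?thesis
      using that(1) by (simp add: inverse_ideal_def[of A "inverse_ideal A S"] mult.commute)
  qed
  then have "inverse_ideal A S \<subseteq> inverse_ideal A T"
    by (auto simp: inverse_ideal_def)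
  then show ?thesis
    unfolding v_closure_def[of A S] v_closure_def[of A T] by (rule inverse_ideal_antimono)
qed

lemma v_closure_ideal:
  assumes "S \<subseteq> A" shows "ideal (v_closure A S) (ring_on A)"
proof -
  have "x + y \<in> v_closure A S" if "x \<in> v_closure A S" "y \<in> v_closure A S" for x y
    using that add_mem by (auto simp: v_closure_iff[OF assms] distrib_right)
  moreover have "a * x \<in> v_closure A S" if "a \<in> A" "x \<in> v_closure A S" for a x
    using that mult_mem by (auto simp: v_closure_iff[OF assms] mult.assoc)
  moreover have "0 \<in> v_closure A S"
    using zero_mem by (auto simp: v_closure_iff[OF assms])
  ultimately show ?thesis
    using v_closure_subset[OF assms] by (auto simp: ideal_iff)
qed

section \<open>The t-closure through finite sets\<close>

lemma ideal_sum:
  assumes "ideal I (ring_on A)" "\<And>s. s \<in> S \<Longrightarrow> f s \<in> I" shows "sum f S \<in> I"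
  using assms(2) assms(1)
  by (induction S rule: infinite_finite_induct) (auto simp: ideal_iff)

lemma proper_iff: "ideal I (ring_on A) \<Longrightarrow> I \<noteq> A \<longleftrightarrow> 1 \<notin> I"
  unfolding ideal_iff using one_mem by (metis mult.right_neutral subsetI subset_antisym)

lemma fractional_ideal_if_ideal:
  assumes "ideal I (ring_on A)" shows "fractional_ideal A I"
proof -
  have "(*) 1 ` I = I" by (simp add: image_def)
  then show ?thesis
    unfolding fractional_ideal_def using assms one_mem subset_quotient_field
    by (intro conjI bexI[of _ 1]) (auto simp: ideal_iff)
qed

text \<open>Passing to inverses only sees generators, so finitely generated ideals may be replaced
  by finite sets.\<close>

lemma t_closure_iff:
  assumes I: "ideal I (ring_on A)"
  shows "y \<in> t_closure A I \<longleftrightarrow>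
    (\<exists>S. finite S \<and> S \<subseteq> I \<and> (\<exists>s\<in>S. s \<noteq> 0) \<and> y \<in> v_closure A S)"
proof -
  \<comment> \<open>For finite \<open>S\<close> this is the ideal generated by \<open>S\<close>, in
    the form used by \<open>fin_gen\<close>.\<close>
  define G where "G S = {\<Sum>s\<in>S. c s * s |c. \<forall>s\<in>S. c s \<in> A}" for S
  have base: "S \<subseteq> G S" if "finite S" for S
  proof
    fix s assume "s \<in> S"
    with that have "(\<Sum>u\<in>S. (if u = s then 1 else 0) * u) = s"
      by (simp add: if_distrib[of "\<lambda>c. c * _"] cong: if_cong)
    then show "s \<in> G S"
      unfolding G_def using zero_mem one_mem
      by (intro CollectI exI[of _ "\<lambda>u. if u = s then 1 else 0"]) auto
  qed
  have least: "G S \<subseteq> J" if "S \<subseteq> J" "ideal J (ring_on A)" for S J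
    using that(1) ideal_sum[OF that(2), of S] that(2) by (auto simp: G_def ideal_iff subset_iff)
  have Gideal: "ideal (G S) (ring_on A)" if "S \<subseteq> A" for S
  proof -
    have "x + y \<in> G S" if "x \<in> G S" "y \<in> G S" for x y
    proof -
      from that obtain c d where "x = (\<Sum>s\<in>S. c s * s)" "y = (\<Sum>s\<in>S. d s * s)"
        "\<forall>s\<in>S. c s \<in> A" "\<forall>s\<in>S. d s \<in> A" by (auto simp: G_def)
      then show ?thesis unfolding G_def using add_mem
        by (intro CollectI exI[of _ "\<lambda>s. c s + d s"]) (auto simp: distrib_right sum.distrib)
    qed
    moreover have "a * x \<in> G S" if "a \<in> A" "x \<in> G S" for a x
    proof -
      from that obtain c where "x = (\<Sum>s\<in>S. c s * s)" "\<forall>s\<in>S. c s \<in> A" by (auto simp: G_def)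
      then show ?thesis unfolding G_def using mult_mem \<open>a \<in> A\<close>
        by (intro CollectI exI[of _ "\<lambda>s. a * c s"]) (auto simp: mult.assoc sum_distrib_left)
    qed
    moreover have "0 \<in> G S" unfolding G_def using zero_mem
      by (intro CollectI exI[of _ "\<lambda>_. 0"]) auto
    moreover have "G S \<subseteq> A"
      using that by (auto simp: G_def intro!: sum_mem mult_mem)
    ultimately show ?thesis by (auto simp: ideal_iff)
  qed
  have inv: "inverse_ideal A (G S) = inverse_ideal A S" if "finite S" for S
  proof
    show "inverse_ideal A (G S) \<subseteq> inverse_ideal A S"
      using base[OF that] by (rule inverse_ideal_antimono)
    show "inverse_ideal A S \<subseteq> inverse_ideal A (G S)"
    proof
      fix x assume x: "x \<in> inverse_ideal A S"
      \<comment> \<open>A multiplier that sends each generator into \<open>A\<close> does the same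
        with every \<open>A\<close>-combination of them.\<close>
      have "x * (\<Sum>s\<in>S. c s * s) \<in> A" if "\<forall>s\<in>S. c s \<in> A" for c
      proof -
        have "(\<Sum>s\<in>S. c s * (x * s)) \<in> A"
          using that x by (auto simp: inverse_ideal_def intro!: sum_mem mult_mem[of "c _" "x * _"])
        then show ?thesis by (simp add: sum_distrib_left mult.left_commute)
      qed
      with x show "x \<in> inverse_ideal A (G S)" by (auto simp: inverse_ideal_def G_def)
    qed
  qed
  have IA: "I \<subseteq> A" using I by (auto simp: ideal_iff)
  show ?thesis
  proof
    assume "y \<in> t_closure A I"
    then obtain J where J: "J \<subseteq> I" "J \<noteq> {0}" "fin_gen A J" "y \<in> v_closure A J"
      by (auto simp: t_closure_def)
    then obtain S where S: "finite S" "J = G S" by (auto simp: fin_gen_def G_def)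
    have "S \<subseteq> I" using base[OF S(1)] S(2) J(1) by auto
    \<comment> \<open>If every generator were 0, so would be every combination, against
      \<open>J \<noteq> {0}\<close>.\<close>
    moreover have "\<exists>s\<in>S. s \<noteq> 0"
    proof (rule ccontr)
      assume "\<not> (\<exists>s\<in>S. s \<noteq> 0)"
      then have "G S \<subseteq> {0}" by (auto simp: G_def intro!: sum.neutral)
      moreover have "0 \<in> G S" using Gideal[of S] \<open>S \<subseteq> I\<close> IA by (auto simp: ideal_iff)
      ultimately show False using J(2) S(2) by auto
    qed
    moreover have "y \<in> v_closure A S"
      using J(4) inv[OF S(1)] S(2) by (simp add: v_closure_def)
    ultimately show "\<exists>S. finite S \<and> S \<subseteq> I \<and> (\<exists>s\<in>S. s \<noteq> 0) \<and> y \<in> v_closure A S"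
      using S(1) by blast
  next
    assume "\<exists>S. finite S \<and> S \<subseteq> I \<and> (\<exists>s\<in>S. s \<noteq> 0) \<and> y \<in> v_closure A S"
    then obtain S where S: "finite S" "S \<subseteq> I" "\<exists>s\<in>S. s \<noteq> 0" "y \<in> v_closure A S" by blast
    have "ideal (G S) (ring_on A)" using Gideal S(2) IA by blast
    then have "fractional_ideal A (G S)" by (rule fractional_ideal_if_ideal)
    moreover have "G S \<subseteq> I" using least S(2) I by blast
    moreover have "G S \<noteq> {0}" using S(3) base[OF S(1)] by auto
    moreover have "fin_gen A (G S)" using S(1) by (auto simp: fin_gen_def G_def)
    moreover have "y \<in> v_closure A (G S)" using S(4) inv[OF S(1)] by (simp add: v_closure_def)
    ultimately show "y \<in> t_closure A I" unfolding t_closure_def by blast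
  qed
qed

lemma subset_t_closure:
  assumes I: "ideal I (ring_on A)" "I \<noteq> {0}" shows "I \<subseteq> t_closure A I"
proof
  fix x assume x: "x \<in> I"
  \<comment> \<open>The companion \<open>i\<close> guarantees a nonzero element in the finite set
    even when \<open>x\<close> is 0.\<close>
  obtain i where i: "i \<in> I" "i \<noteq> 0" using I by (auto simp: ideal_iff)
  have "x \<in> v_closure A {x, i}"
    using subset_v_closure[of "{x, i}"] x i I by (auto simp: ideal_iff)
  then show "x \<in> t_closure A I"
    unfolding t_closure_iff[OF I(1)] using x i by (intro exI[of _ "{x, i}"]) auto
qed

text \<open>An ideal always lies in its t-closure, so only the inclusion of \<open>I_t\<close> in
  \<open>I\<close> is at stake, and this can be tested on one finite set at a time.\<close>

lemma integral_t_ideals_iff: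
  "I \<in> integral_t_ideals A \<longleftrightarrow> I \<in> integral_ideals A \<and>
     (\<forall>S. finite S \<and> S \<subseteq> I \<and> (\<exists>s\<in>S. s \<noteq> 0) \<longrightarrow> v_closure A S \<subseteq> I)"
proof (cases "I \<in> integral_ideals A")
  case True
  then have I: "ideal I (ring_on A)" "I \<noteq> {0}" by (auto simp: integral_ideals_def)
  have "fractional_ideal A I" using I(1) by (rule fractional_ideal_if_ideal)
  then have "I \<in> integral_t_ideals A \<longleftrightarrow> t_closure A I \<subseteq> I"
    using True I subset_t_closure[OF I] by (auto simp: integral_t_ideals_def t_ideal_def)
  also have "\<dots> \<longleftrightarrow> (\<forall>S. finite S \<and> S \<subseteq> I \<and> (\<exists>s\<in>S. s \<noteq> 0) \<longrightarrow> v_closure A S \<subseteq> I)"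
    unfolding subset_iff[of "t_closure A I"] t_closure_iff[OF I(1)] by blast
  finally show ?thesis using True by simp
qed (auto simp: integral_t_ideals_def)

section \<open>Directed unions of ideals, and two sources of t-ideals\<close>

lemma directed_Union_ideal:
  assumes C: "C \<noteq> {}" "\<And>I. I \<in> C \<Longrightarrow> ideal I (ring_on A)"
    and dir: "\<forall>I\<in>C. \<forall>J\<in>C. \<exists>K\<in>C. I \<subseteq> K \<and> J \<subseteq> K"
  shows "ideal (\<Union>C) (ring_on A)"
proof -
  have "x + y \<in> \<Union>C" if "x \<in> \<Union>C" "y \<in> \<Union>C" for x y
  proof -
    from that obtain I J where "I \<in> C" "J \<in> C" "x \<in> I" "y \<in> J" by blast
    with dir obtain K where "K \<in> C" "x \<in> K" "y \<in> K" by blast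
    then show ?thesis using C(2) by (auto simp: ideal_iff)
  qed
  moreover have "a * x \<in> \<Union>C" if "a \<in> A" "x \<in> \<Union>C" for a x
    using that C(2) unfolding ideal_iff by blast
  moreover have "\<Union>C \<subseteq> A" "0 \<in> \<Union>C" using C unfolding ideal_iff by blast+
  ultimately show ?thesis unfolding ideal_iff by blast
qed

lemma directed_finite_subset:
  assumes "C \<noteq> {}" and dir: "\<forall>I\<in>C. \<forall>J\<in>C. \<exists>K\<in>C. I \<subseteq> K \<and> J \<subseteq> K"
    and "finite S" "S \<subseteq> \<Union>C"
  shows "\<exists>K\<in>C. S \<subseteq> K"
  using assms(3,4)
proof (induction S)
  case (insert s S)
  then obtain K I where KI: "K \<in> C" "S \<subseteq> K" "I \<in> C" "s \<in> I" by auto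
  then obtain K' where "K' \<in> C" "K \<subseteq> K'" "I \<subseteq> K'" using dir by meson
  with KI show ?case by (intro bexI[of _ K']) auto
qed (use assms(1) in auto)

text \<open>\<open>I_t\<close> is the directed union of the \<open>S_v\<close> over finite
  \<open>S\<close> in \<open>I\<close>. A finite subset of the union already lies in one
  \<open>S_v\<close>, which then contains its v-closure by \<open>v_closure_least\<close>. The
  assumption on 1 makes the union proper.\<close>

lemma t_closure_integral_t_ideal:
  assumes I: "ideal I (ring_on A)" "I \<noteq> {0}" and "1 \<notin> t_closure A I"
  shows "t_closure A I \<in> integral_t_ideals A"
proof -
  have IA: "I \<subseteq> A" using I by (auto simp: ideal_iff)
  define C where "C = {v_closure A S |S. finite S \<and> S \<subseteq> I \<and> (\<exists>s\<in>S. s \<noteq> 0)}"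
  have eq: "t_closure A I = \<Union>C"
    unfolding C_def set_eq_iff t_closure_iff[OF I(1)] by blast
  have dir: "\<forall>I\<in>C. \<forall>J\<in>C. \<exists>K\<in>C. I \<subseteq> K \<and> J \<subseteq> K"
  proof (intro ballI)
    fix J J' assume "J \<in> C" "J' \<in> C"
    then obtain S T where "J = v_closure A S" "J' = v_closure A T" "finite S" "finite T"
      "S \<subseteq> I" "T \<subseteq> I" "\<exists>s\<in>S. s \<noteq> 0" by (auto simp: C_def)
    then show "\<exists>K\<in>C. J \<subseteq> K \<and> J' \<subseteq> K"
      by (intro bexI[of _ "v_closure A (S \<union> T)"]) (auto simp: C_def intro: v_closure_mono[THEN subsetD])
  qed
  have ne: "C \<noteq> {}" using subset_t_closure[OF I] I by (auto simp: eq ideal_iff)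
  have "ideal (\<Union>C) (ring_on A)"
    using ne
  proof (rule directed_Union_ideal)
    show "ideal J (ring_on A)" if "J \<in> C" for J
      using that IA v_closure_ideal by (auto simp: C_def)
  qed (fact dir)
  moreover have "\<Union>C \<noteq> {0}" "\<Union>C \<noteq> A"
    using subset_t_closure[OF I] I assms(3) one_mem by (auto simp: eq ideal_iff)
  moreover have "v_closure A T \<subseteq> \<Union>C" if T: "finite T" "T \<subseteq> \<Union>C" for T
  proof -
    obtain K where "K \<in> C" "T \<subseteq> K" using directed_finite_subset[OF ne dir T] by blast
    moreover from \<open>K \<in> C\<close> obtain S where "K = v_closure A S" by (auto simp: C_def)
    ultimately have "v_closure A T \<subseteq> K" using v_closure_least by simp
    with \<open>K \<in> C\<close> show ?thesis by blast
  qed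
  ultimately show ?thesis unfolding integral_t_ideals_iff eq integral_ideals_def by blast
qed

text \<open>If \<open>S\<close> lies in gA, then \<open>1 / g\<close> belongs to the inverse of
  \<open>S\<close> and so sends \<open>S_v\<close> into \<open>A\<close>. Hence gA contains the
  v-closure of each of its subsets. It is proper because \<open>g\<close> is not a unit.\<close>

lemma principal_integral_t_ideal:
  assumes g: "g \<in> A" "g \<noteq> 0" "1 / g \<notin> A"
  shows "(*) g ` A \<in> integral_t_ideals A"
proof -
  have "g * x + g * y \<in> (*) g ` A" if "x \<in> A" "y \<in> A" for x y
    using add_mem[OF that] by (metis distrib_left image_eqI)
  moreover have "a * (g * x) \<in> (*) g ` A" if "a \<in> A" "x \<in> A" for a x
    using mult_mem[OF that] by (metis mult.left_commute image_eqI)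
  ultimately have id: "ideal ((*) g ` A) (ring_on A)"
    using g mult_mem zero_mem by (auto simp: ideal_iff image_iff)
  moreover have "1 \<notin> (*) g ` A" 
  proof
    assume "1 \<in> (*) g ` A"
    then obtain x where "x \<in> A" "1 = g * x" by blast
    then show False using g by (metis nonzero_mult_div_cancel_left)
  qed
  moreover have "g \<in> (*) g ` A" using one_mem by force
  ultimately have "(*) g ` A \<in> integral_ideals A"
    using g one_mem by (auto simp: integral_ideals_def)
  moreover have "v_closure A S \<subseteq> (*) g ` A" if S: "S \<subseteq> (*) g ` A" for S
  proof
    fix y assume y: "y \<in> v_closure A S"
    have "1 / g \<in> inverse_ideal A S"
      using S g one_mem by (auto simp: inverse_ideal_def quotient_field_def)
    then have "y * (1 / g) \<in> A" using y by (auto simp: v_closure_def inverse_ideal_def)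
    then show "y \<in> (*) g ` A" using g by (intro image_eqI[of _ _ "y / g"]) auto
  qed
  ultimately show ?thesis by (auto simp: integral_t_ideals_iff)
qed

lemma principalideal_image:
  assumes "g \<in> A" shows "principalideal ((*) g ` A) (ring_on A)"
proof -
  interpret domain "ring_on A" by (rule domain_ring_on)
  have "(*) g ` A = cgenideal (ring_on A) g"
    by (auto simp: cgenideal_def ring_on_def mult.commute)
  with cgenideal_is_principalideal[of g] assms show ?thesis by (simp add: ring_on_def)
qed

end

lemma domain_ring_on_iff: "domain (ring_on A) \<longleftrightarrow> field_subring A"
proof
  assume "domain (ring_on A)"
  then interpret domain "ring_on A" .
  have "- x \<in> A" if "x \<in> A" for x
  proof -
    have "\<ominus>\<^bsub>ring_on A\<^esub> x \<in> A" "\<ominus>\<^bsub>ring_on A\<^esub> x + x = 0"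
      using a_inv_closed[of x] l_neg[of x] that by (auto simp: ring_on_def)
    then show ?thesis by (simp add: eq_neg_iff_add_eq_0[symmetric])
  qed
  then show "field_subring A"
    using zero_closed one_closed a_closed m_closed by unfold_locales (auto simp: ring_on_def)
qed (rule field_subring.domain_ring_on)

section \<open>Maximal members of the two families of ideals\<close>

definition maximal_in :: "'a set set \<Rightarrow> 'a set \<Rightarrow> bool" where
  "maximal_in F M \<longleftrightarrow> M \<in> F \<and> (\<forall>I\<in>F. M \<subseteq> I \<longrightarrow> I = M)"

text \<open>Zorn's lemma for the members of \<open>F\<close> above \<open>I\<close>. Chains are
  directed, so closure under directed unions, the form in which it is proved for ideals,
  suffices.\<close>

lemma exists_maximal_in:
  assumes "I \<in> F"
    and chain: "\<And>C. C \<noteq> {} \<Longrightarrow> C \<subseteq> F \<Longrightarrow> \<forall>I\<in>C. \<forall>J\<in>C. \<exists>K\<in>C. I \<subseteq> K \<and> J \<subseteq> K \<Longrightarrow> \<Union>C \<in> F"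
  shows "\<exists>M. maximal_in F M \<and> I \<subseteq> M"
proof -
  have "\<exists>M\<in>{J\<in>F. I \<subseteq> J}. \<forall>X\<in>{J\<in>F. I \<subseteq> J}. M \<subseteq> X \<longrightarrow> X = M"
  proof (rule subset_Zorn_nonempty)
    fix C assume C: "C \<noteq> {}" "subset.chain {J\<in>F. I \<subseteq> J} C"
    have "\<Union>C \<in> F"
    proof (rule chain)
      show "\<forall>I\<in>C. \<forall>J\<in>C. \<exists>K\<in>C. I \<subseteq> K \<and> J \<subseteq> K"
      proof (intro ballI)
        fix X Y assume XY: "X \<in> C" "Y \<in> C"
        with C(2) have "X \<subseteq> Y \<or> Y \<subseteq> X" by (simp add: subset_chain_def)
        then show "\<exists>K\<in>C. X \<subseteq> K \<and> Y \<subseteq> K" using XY by auto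
      qed
    qed (use C in \<open>auto simp: subset_chain_def\<close>)
    moreover have "I \<subseteq> \<Union>C" using C unfolding subset_chain_def by blast
    ultimately show "\<Union>C \<in> {J\<in>F. I \<subseteq> J}" by simp
  qed (use assms in auto)
  then obtain M where M: "M \<in> F" "I \<subseteq> M" "\<forall>X\<in>{J\<in>F. I \<subseteq> J}. M \<subseteq> X \<longrightarrow> X = M"
    by auto
  then have "maximal_in F M" by (auto simp: maximal_in_def)
  with M(2) show ?thesis by blast
qed

context field_subring
begin

lemma directed_Union_integral_ideals:
  assumes "C \<noteq> {}" "C \<subseteq> integral_ideals A"
    and "\<forall>I\<in>C. \<forall>J\<in>C. \<exists>K\<in>C. I \<subseteq> K \<and> J \<subseteq> K"
  shows "\<Union>C \<in> integral_ideals A"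
proof -
  have id: "ideal I (ring_on A)" "1 \<notin> I" "I \<noteq> {0}" if "I \<in> C" for I
    using that assms(2) proper_iff by (auto simp: integral_ideals_def)
  have "ideal (\<Union>C) (ring_on A)" using assms id by (intro directed_Union_ideal) auto
  moreover have "1 \<notin> \<Union>C" using id by auto
  moreover obtain I where "I \<in> C" using assms(1) by blast
  then have "\<Union>C \<noteq> {0}" using id[of I] by (auto simp: ideal_iff)
  ultimately show ?thesis using one_mem by (auto simp: integral_ideals_def)
qed

lemma exists_maximal_integral_ideal:
  "I \<in> integral_ideals A \<Longrightarrow> \<exists>M. maximal_in (integral_ideals A) M \<and> I \<subseteq> M"
  by (rule exists_maximal_in) (auto intro: directed_Union_integral_ideals)

text \<open>A finite subset of a directed union lies in a single member, and that member, being a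
  t-ideal, contains its v-closure. So the union is again a t-ideal.\<close>

lemma exists_maximal_integral_t_ideal:
  assumes "I \<in> integral_t_ideals A"
  shows "\<exists>M. maximal_in (integral_t_ideals A) M \<and> I \<subseteq> M"
  using assms
proof (rule exists_maximal_in)
  fix C assume C: "C \<noteq> {}" "C \<subseteq> integral_t_ideals A"
    and dir: "\<forall>I\<in>C. \<forall>J\<in>C. \<exists>K\<in>C. I \<subseteq> K \<and> J \<subseteq> K"
  have "\<Union>C \<in> integral_ideals A"
    using C dir by (intro directed_Union_integral_ideals) (auto simp: integral_t_ideals_def)
  moreover have "v_closure A S \<subseteq> \<Union>C" if S: "finite S" "S \<subseteq> \<Union>C" "\<exists>s\<in>S. s \<noteq> 0" for S
  proof -
    obtain K where "K \<in> C" "S \<subseteq> K" using directed_finite_subset[OF C(1) dir S(1,2)] by blast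
    then show ?thesis using C(2) S integral_t_ideals_iff[of K] by blast
  qed
  ultimately show "\<Union>C \<in> integral_t_ideals A" by (auto simp: integral_t_ideals_iff)
qed

text \<open>This leads from maximality in I(A), which Zorn's lemma provides, to the maximal ideals
  in the hypotheses on \<open>P\<close>. The latter are compared with all ideals, but any ideal
  above the nonzero \<open>M\<close> is itself nonzero.\<close>

lemma maximalideal_if_maximal_in:
  assumes "maximal_in (integral_ideals A) M" shows "maximalideal M (ring_on A)"
proof -
  have carrier: "carrier (ring_on A) = A" by (simp add: ring_on_def)
  have M: "ideal M (ring_on A)" "M \<noteq> {0}" "M \<noteq> A"
    using assms by (auto simp: maximal_in_def integral_ideals_def)
  have "0 \<in> M" using M(1) by (simp add: ideal_iff)
  show ?thesis
  proof (rule maximalidealI)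
    fix J assume J: "ideal J (ring_on A)" "M \<subseteq> J"
    have "J \<noteq> {0}" using J(2) M(2) \<open>0 \<in> M\<close> by auto
    then have "J \<noteq> A \<Longrightarrow> J = M"
      using assms J by (simp add: maximal_in_def integral_ideals_def)
    then show "J = M \<or> J = carrier (ring_on A)" by (auto simp: carrier)
  qed (use M in \<open>auto simp: carrier\<close>)
qed

end

section \<open>The ring D + XB and the extension of ideals of D to it\<close>

definition constant_term :: "'l::field fls \<Rightarrow> 'l fls" where
  "constant_term f = fls_const (fls_nth f 0)"

lemma constant_term_0 [simp]: "constant_term 0 = 0"
  and constant_term_1 [simp]: "constant_term 1 = 1"
  and constant_term_idem [simp]: "constant_term (constant_term f) = constant_term f"
  and constant_term_add [simp]: "constant_term (f + g) = constant_term f + constant_term g"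
  and constant_term_diff [simp]: "constant_term (f - g) = constant_term f - constant_term g"
  and constant_term_uminus [simp]: "constant_term (- f) = - constant_term f"
  by (simp_all add: constant_term_def fls_plus_const fls_minus_const)

lemma constant_term_constants [simp]: "c \<in> constants \<Longrightarrow> constant_term c = c"
  by (auto simp: constants_def constant_term_def)

text \<open>\<open>B\<close> stands for $L[X]$ or $L[[X]]$, so that \<open>extension D\<close> is $D + XB$.\<close>

locale constant_extension = field_subring D + B: field_subring B
  for D B :: "'l::field fls set" +
  assumes D_constants: "quotient_field D \<subseteq> constants"
    and D_not_field: "\<exists>a\<in>D. a \<noteq> 0 \<and> 1 / a \<notin> D"
    and B_power_series: "B \<subseteq> range fps_to_fls"
    and constants_B: "constants \<subseteq> B"
begin

definition extension :: "'l fls set \<Rightarrow> 'l fls set" where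
  "extension M = {f \<in> B. constant_term f \<in> M}"

abbreviation R where "R \<equiv> extension D"

lemma D_subset_constants: "D \<subseteq> constants"
  using subset_quotient_field D_constants by blast

lemma constant_term_D [simp]: "d \<in> D \<Longrightarrow> constant_term d = d"
  using D_subset_constants by auto

text \<open>Elements of \<open>B\<close> are power series, where taking the coefficient of index 0
  is multiplicative. In all of L((X)) this fails, for instance for X and 1/X.\<close>

lemma constant_term_mult: "f \<in> B \<Longrightarrow> g \<in> B \<Longrightarrow> constant_term (f * g) = constant_term f * constant_term g"
proof -
  assume "f \<in> B" "g \<in> B"
  then obtain f' g' where "f = fps_to_fls f'" "g = fps_to_fls g'" using B_power_series by blast
  then show ?thesis by (simp add: constant_term_def flip: fls_times_fps_to_fls)
qed

lemma D_subset_B: "D \<subseteq> B"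
  using D_subset_constants constants_B by blast

lemma R_subset_B: "R \<subseteq> B"
  by (auto simp: extension_def)

lemma constants_inverse: "c \<in> constants \<Longrightarrow> 1 / c \<in> constants"
  by (auto simp: constants_def fls_const_divide_const simp flip: fls_const_1)

sublocale R: field_subring R
proof
  show "x * y \<in> R" if "x \<in> R" "y \<in> R" for x y
    using that constant_term_mult[of x y] mult_mem B.mult_mem by (auto simp: extension_def)
  show "x + y \<in> R" if "x \<in> R" "y \<in> R" for x y
    using that add_mem B.add_mem by (auto simp: extension_def)
  show "- x \<in> R" if "x \<in> R" for x
    using that uminus_mem[of "constant_term x"] B.uminus_mem by (auto simp: extension_def)
qed (use zero_mem one_mem B.zero_mem B.one_mem in \<open>auto simp: extension_def\<close>)

lemma D_subset_R: "D \<subseteq> R"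
  using D_subset_B by (auto simp: extension_def)

lemma mem_R_if_constant_term_0: "f \<in> B \<Longrightarrow> constant_term f = 0 \<Longrightarrow> f \<in> R"
  using zero_mem by (auto simp: extension_def)

lemma extension_ideal:
  assumes "ideal M (ring_on D)" shows "ideal (extension M) (ring_on R)"
  unfolding R.ideal_iff
proof (intro conjI ballI)
  show "extension M \<subseteq> R" "0 \<in> extension M"
    using assms B.zero_mem by (auto simp: extension_def ideal_iff)
  show "x + y \<in> extension M" if "x \<in> extension M" "y \<in> extension M" for x y
    using that assms B.add_mem
    by (auto simp: extension_def ideal_iff)
  show "a * x \<in> extension M" if "a \<in> R" "x \<in> extension M" for a x
    using that constant_term_mult[of a x] assms B.mult_mem
    by (auto simp: extension_def ideal_iff)
qed

lemma extension_inter_D: "M \<subseteq> D \<Longrightarrow> extension M \<inter> D = M"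
  using D_subset_B by (auto simp: extension_def)

lemma extension_integral_ideal:
  assumes "M \<in> integral_ideals D" shows "extension M \<in> integral_ideals R"
proof -
  have M: "ideal M (ring_on D)" "M \<subseteq> D" "M \<noteq> {0}" "1 \<notin> M"
    using assms proper_iff by (auto simp: integral_ideals_def ideal_iff)
  then obtain m where "m \<in> M" "m \<noteq> 0" by (auto simp: ideal_iff)
  then have "extension M \<noteq> {0}" using extension_inter_D[OF M(2)] by auto
  moreover have "1 \<notin> extension M" using M by (auto simp: extension_def)
  ultimately show ?thesis
    using extension_ideal[OF M(1)] R.one_mem by (auto simp: integral_ideals_def)
qed

lemma ideal_inter_D:
  assumes "ideal N (ring_on R)" shows "ideal (N \<inter> D) (ring_on D)"
  using assms D_subset_R add_mem mult_mem zero_mem by (auto simp: ideal_iff R.ideal_iff)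

text \<open>\<open>extension M\<close> contains every element of \<open>B\<close> with constant term
  0, so \<open>N\<close> contains XB. Therefore membership of an element of \<open>R\<close> in
  \<open>N\<close> depends only on its constant term.\<close>

lemma eq_extension:
  assumes N: "ideal N (ring_on R)" and M: "ideal M (ring_on D)" "extension M \<subseteq> N"
  shows "N = extension (N \<inter> D)"
proof -
  have diff: "f - constant_term f \<in> N" if "f \<in> R" for f
  proof -
    have "f - constant_term f \<in> B"
      using that D_subset_B by (auto simp: extension_def intro: B.diff_mem)
    then have "f - constant_term f \<in> extension M"
      using M(1) by (auto simp: extension_def ideal_iff)
    with M(2) show ?thesis by blast
  qed
  show ?thesis
  proof (intro subset_antisym subsetI)
    fix f assume f: "f \<in> N"
    then have R: "f \<in> R" using N by (auto simp: R.ideal_iff)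
    have "f + (- 1) * (f - constant_term f) \<in> N"
      using f diff[OF R] N R.one_mem R.uminus_mem unfolding R.ideal_iff by blast
    then have "constant_term f \<in> N" by simp
    then show "f \<in> extension (N \<inter> D)" using R by (auto simp: extension_def)
  next
    fix f assume f: "f \<in> extension (N \<inter> D)"
    then have "f \<in> R" "constant_term f \<in> N" by (auto simp: extension_def)
    then have "(f - constant_term f) + constant_term f \<in> N"
      using diff N unfolding R.ideal_iff by blast
    then show "f \<in> N" by simp
  qed
qed

lemma quotient_field_D_subset_R: "quotient_field D \<subseteq> quotient_field R"
  using D_subset_R by (auto simp: quotient_field_def)

text \<open>Both directions compare inverses over \<open>D\<close> and over \<open>R\<close>. For
  \<open>S\<close> in \<open>M\<close> with a nonzero element, an inverse element over
  \<open>R\<close> lies in \<open>B\<close> and has a constant term inverse to \<open>S\<close> over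
  \<open>D\<close>, so \<open>S_v\<close> over \<open>D\<close> lies in \<open>S_v\<close> over
  \<open>R\<close>. For \<open>S\<close> in \<open>extension M\<close>, elements inverse to the
  constant terms over \<open>D\<close> are inverse to \<open>S\<close> over \<open>R\<close>, so
  \<open>S_v\<close> over \<open>R\<close> has its constant terms in \<open>M\<close>.\<close>

lemma extension_integral_t_ideal_iff:
  assumes M: "M \<in> integral_ideals D"
  shows "extension M \<in> integral_t_ideals R \<longleftrightarrow> M \<in> integral_t_ideals D"
proof
  have M': "ideal M (ring_on D)" "M \<subseteq> D" "M \<noteq> {0}"
    using M by (auto simp: integral_ideals_def ideal_iff)
  {
    assume t: "extension M \<in> integral_t_ideals R"
    have "v_closure D S \<subseteq> M" if S: "finite S" "S \<subseteq> M" "s \<in> S" "s \<noteq> 0" for S s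
    proof
      fix y assume y: "y \<in> v_closure D S"
      have SD: "S \<subseteq> D" and SR: "S \<subseteq> R" using S(2) M'(2) D_subset_R by auto
      have yD: "y \<in> D" using y v_closure_subset[OF SD] by blast
      have "y * x \<in> R" if x: "x \<in> inverse_ideal R S" for x
      proof -
        have xs: "x * s' \<in> R" if "s' \<in> S" for s' using x that by (auto simp: inverse_ideal_def)
        \<comment> \<open>The nonzero constant \<open>s\<close> is a unit of \<open>B\<close>, so
          \<open>x\<close> can be recovered inside \<open>B\<close> from
          \<open>x * s\<close>.\<close>
        have "1 / s \<in> B" using SD S(3) D_subset_constants constants_inverse constants_B by blast
        then have "x * s * (1 / s) \<in> B" using xs[OF S(3)] R_subset_B B.mult_mem by blast
        then have xB: "x \<in> B" using S(4) by simp
        have xD: "constant_term x * s' \<in> D" if "s' \<in> S" for s'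
        proof -
          have "constant_term (x * s') = constant_term x * constant_term s'"
            using that SD D_subset_B by (intro constant_term_mult xB) auto
          then show ?thesis using xs[OF that] that SD constant_term_D[of s']
            by (auto simp: extension_def)
        qed
        \<comment> \<open>A quotient of two elements of \<open>D\<close>: this gives the quotient
          field part of membership in the inverse over \<open>D\<close>.\<close>
        have "constant_term x = (constant_term x * s) / s" using S(4) by simp
        then have "constant_term x \<in> quotient_field D"
          using xD[OF S(3)] SD S(3,4) unfolding quotient_field_iff by blast
        then have "constant_term x \<in> inverse_ideal D S"
          using xD by (auto simp: inverse_ideal_def)
        then have "y * constant_term x \<in> D" using y v_closure_iff[OF SD] by blast
        moreover have "constant_term (y * x) = y * constant_term x"
          using constant_term_mult[of y x] yD D_subset_B xB by auto
        moreover have "y * x \<in> B" using yD D_subset_B xB B.mult_mem by blast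
        ultimately show ?thesis by (simp add: extension_def)
      qed
      then have "y \<in> v_closure R S"
        using yD D_subset_R R.v_closure_iff[OF SR] by blast
      moreover have "S \<subseteq> extension M" using S(2) SD extension_inter_D[OF M'(2)] by blast
      then have "v_closure R S \<subseteq> extension M" using t S unfolding R.integral_t_ideals_iff by blast
      ultimately have "y \<in> extension M \<inter> D" using yD by blast
      then show "y \<in> M" using extension_inter_D[OF M'(2)] by simp
    qed
    then show "M \<in> integral_t_ideals D" using M unfolding integral_t_ideals_iff by blast
  }
  assume t: "M \<in> integral_t_ideals D"
  have "v_closure R S \<subseteq> extension M" if S: "finite S" "S \<subseteq> extension M" for S
  proof
    fix y assume y: "y \<in> v_closure R S"
    obtain m where m: "m \<in> M" "m \<noteq> 0" using M' by (auto simp: ideal_iff)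
    \<comment> \<open>All constant terms of \<open>S\<close> may vanish; inserting \<open>m\<close>
      secures a nonzero element, as the t-ideal property of \<open>M\<close> requires.\<close>
    define J where "J = insert m (constant_term ` S)"
    have J: "finite J" "J \<subseteq> M" "m \<in> J" "J \<subseteq> D"
      using S m M' by (auto simp: J_def extension_def)
    have SR: "S \<subseteq> R" using S(2) extension_ideal[OF M'(1)] by (auto simp: R.ideal_iff)
    have yR: "y \<in> R" using y R.v_closure_subset[OF SR] by blast
    have "constant_term y * x \<in> D" if x: "x \<in> inverse_ideal D J" for x
    proof -
      \<comment> \<open>The quotient field of \<open>D\<close> consists of constants, so
        \<open>x\<close> lies in \<open>B\<close> and is its own constant term.\<close>
      have xq: "x \<in> quotient_field D" using x by (auto simp: inverse_ideal_def)
      then have xB: "x \<in> B" and xc: "constant_term x = x"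
        using D_constants constants_B by auto
      have "x * f \<in> R" if "f \<in> S" for f
      proof -
        have "f \<in> B" using that SR R_subset_B by blast
        moreover have "x * constant_term f \<in> D" using x that by (auto simp: inverse_ideal_def J_def)
        ultimately show ?thesis
          using constant_term_mult[of x f] xB xc B.mult_mem by (auto simp: extension_def)
      qed
      then have "x \<in> inverse_ideal R S"
        using xq quotient_field_D_subset_R by (auto simp: inverse_ideal_def)
      then have "y * x \<in> R" using y R.v_closure_iff[OF SR] by blast
      then show ?thesis
        using constant_term_mult[of y x] yR xB xc by (auto simp: extension_def)
    qed
    then have "constant_term y \<in> v_closure D J"
      using yR v_closure_iff[OF J(4)] by (auto simp: extension_def)
    then have "constant_term y \<in> M" using t J m(2) unfolding integral_t_ideals_iff by blast
    then show "y \<in> extension M" using yR by (auto simp: extension_def)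
  qed
  then show "extension M \<in> integral_t_ideals R"
    using extension_integral_ideal[OF M] unfolding R.integral_t_ideals_iff by blast
qed

section \<open>Constant terms of ideals of R, and the comparison of D with R\<close>

lemma ideal_constant_terms:
  assumes N: "ideal N (ring_on R)" shows "ideal (constant_term ` N) (ring_on D)"
  unfolding ideal_iff
proof (intro conjI ballI)
  have NR: "N \<subseteq> R" using N by (simp add: R.ideal_iff)
  then show "constant_term ` N \<subseteq> D" by (auto simp: extension_def)
  show "0 \<in> constant_term ` N" using N by (force simp: R.ideal_iff)
  show "x + y \<in> constant_term ` N" if "x \<in> constant_term ` N" "y \<in> constant_term ` N" for x y
  proof -
    from that obtain f g where "f \<in> N" "g \<in> N" "x = constant_term f" "y = constant_term g" by blast
    moreover from this have "f + g \<in> N" using N unfolding R.ideal_iff by blast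
    ultimately show ?thesis by (metis constant_term_add image_eqI)
  qed
  show "a * x \<in> constant_term ` N" if a: "a \<in> D" and "x \<in> constant_term ` N" for a x
  proof -
    from that obtain f where f: "f \<in> N" "x = constant_term f" by blast
    then have "constant_term (a * f) = a * x"
      using constant_term_mult[of a f] a D_subset_B NR R_subset_B by auto
    moreover have "a * f \<in> N" using a f N D_subset_R unfolding R.ideal_iff by blast
    ultimately show ?thesis by (metis image_eqI)
  qed
qed

text \<open>A nonzero nonunit of \<open>D\<close> generates a proper principal t-ideal. This
  provides a target for those ideals of \<open>R\<close> whose constant terms are all 0.\<close>

lemma integral_t_ideals_nonempty: "integral_t_ideals D \<noteq> {}"
  using D_not_field principal_integral_t_ideal by blast

text \<open>The condition NB = B. It is written with an explicit finite relation because the t-case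
  needs the finite subset \<open>F\<close> of \<open>N\<close> itself.\<close>

definition spans :: "'l fls set \<Rightarrow> bool" where
  "spans N \<longleftrightarrow> (\<exists>F h. finite F \<and> F \<subseteq> N \<and> (\<forall>f\<in>F. h f \<in> B) \<and> (\<Sum>f\<in>F. h f * f) = 1)"

text \<open>Since \<open>1 - f\<close> has constant term 0, it multiplies \<open>B\<close> into XB,
  hence into \<open>R\<close>. Multiplying the relation with value 1 by \<open>1 - f\<close> turns
  its coefficients into elements of \<open>R\<close>, which yields \<open>1 - f\<close> in
  \<open>N\<close>.\<close>

lemma one_mem_if_spans:
  assumes N: "ideal N (ring_on R)" and "spans N" and f: "f \<in> N" "constant_term f = 1"
  shows "1 \<in> N"
proof -
  obtain F h where F: "F \<subseteq> N" "\<forall>f\<in>F. h f \<in> B" "(\<Sum>f\<in>F. h f * f) = 1"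
    using assms(2) by (auto simp: spans_def)
  have "f \<in> B" using f(1) N R_subset_B by (auto simp: R.ideal_iff)
  then have g: "1 - f \<in> B" "constant_term (1 - f) = 0"
    using f(2) B.one_mem by (auto intro: B.diff_mem)
  have "(1 - f) * h u \<in> R" if "u \<in> F" for u
    using that g F(2) constant_term_mult[of "1 - f" "h u"] B.mult_mem
    by (intro mem_R_if_constant_term_0) auto
  then have "(1 - f) * h u * u \<in> N" if "u \<in> F" for u
    using that F(1) N unfolding R.ideal_iff by blast
  then have "(\<Sum>u\<in>F. (1 - f) * h u * u) \<in> N" by (rule R.ideal_sum[OF N])
  then have "(1 - f) * (\<Sum>u\<in>F. h u * u) \<in> N" by (simp add: sum_distrib_left mult.assoc)
  then have "1 - f \<in> N" using F(3) by simp
  then have "(1 - f) + f \<in> N" using f(1) N unfolding R.ideal_iff by blast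
  then show ?thesis by simp
qed

text \<open>If the constant terms of $N$ have $t$-closure $D$ and $N$ generates $B$, then some finite
  part $F$ of $N$ has $F^{-1} = R$.\<close>

lemma one_notin_t_closure_if_spans:
  assumes N: "N \<in> integral_t_ideals R" and "spans N"
  shows "1 \<notin> t_closure D (constant_term ` N)"
proof
  have NI: "ideal N (ring_on R)" "1 \<notin> N" and NR: "N \<subseteq> R"
    using N R.proper_iff by (auto simp: R.integral_t_ideals_iff integral_ideals_def R.ideal_iff)
  assume "1 \<in> t_closure D (constant_term ` N)"
  then obtain S where S: "finite S" "S \<subseteq> constant_term ` N" "\<exists>s\<in>S. s \<noteq> 0" "1 \<in> v_closure D S"
    unfolding t_closure_iff[OF ideal_constant_terms[OF NI(1)]] by blast
  \<comment> \<open>Finitely many elements of \<open>N\<close> whose constant terms are exactly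
    \<open>S\<close>. Together, \<open>E\<close> controls constant terms and \<open>F\<close>
    controls membership in \<open>B\<close>.\<close>
  obtain E where E: "finite E" "E \<subseteq> N" "S = constant_term ` E"
    using finite_subset_image[OF S(1,2)] by blast
  have SD: "S \<subseteq> D" using S(2) ideal_constant_terms[OF NI(1)] by (auto simp: ideal_iff)
  obtain F h where F: "finite F" "F \<subseteq> N" "\<forall>f\<in>F. h f \<in> B" "(\<Sum>f\<in>F. h f * f) = 1"
    using assms(2) by (auto simp: spans_def)
  have sub: "E \<union> F \<subseteq> R" using E F NR by blast
  have "x \<in> R" if x: "x \<in> inverse_ideal R (E \<union> F)" for x
  proof -
    have xf: "x * f \<in> R" if "f \<in> E \<union> F" for f using x that by (auto simp: inverse_ideal_def)
    \<comment> \<open>The relation with value 1 writes \<open>x\<close> as a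
      \<open>B\<close>-combination of the products \<open>x * f\<close>, which lie in
      \<open>R\<close>.\<close>
    have "(\<Sum>f\<in>F. h f * (x * f)) \<in> B"
      using xf F(3) R_subset_B by (auto intro!: B.sum_mem B.mult_mem[of "h _" "x * _"])
    also have "(\<Sum>f\<in>F. h f * (x * f)) = x * (\<Sum>f\<in>F. h f * f)"
      by (simp add: sum_distrib_left mult.left_commute)
    finally have xB: "x \<in> B" using F(4) by simp
    have xD: "constant_term x * s \<in> D" if "s \<in> S" for s
    proof -
      from that E obtain f where f: "f \<in> E" "s = constant_term f" by blast
      then have "constant_term (x * f) = constant_term x * s"
        using sub R_subset_B constant_term_mult[OF xB, of f] by auto
      then show ?thesis using xf[of f] f(1) by (auto simp: extension_def)
    qed
    \<comment> \<open>Dividing by a nonzero \<open>s\<close> places the constant term of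
      \<open>x\<close> in the quotient field; as 1 is in the v-closure of \<open>S\<close>, the
      inverse of \<open>S\<close> is contained in \<open>D\<close>.\<close>
    obtain s where s: "s \<in> S" "s \<noteq> 0" using S(3) by blast
    then have "constant_term x = (constant_term x * s) / s" by simp
    then have "constant_term x \<in> quotient_field D"
      using xD[OF s(1)] SD s unfolding quotient_field_iff by blast
    then have "constant_term x \<in> inverse_ideal D S" using xD by (auto simp: inverse_ideal_def)
    then have "1 * constant_term x \<in> D" using S(4) v_closure_iff[OF SD] by blast
    then show "x \<in> R" using xB by (simp add: extension_def)
  qed
  then have "1 \<in> v_closure R (E \<union> F)"
    using R.one_mem R.v_closure_iff[OF sub] by auto
  moreover have "\<exists>f\<in>E \<union> F. f \<noteq> 0"
  proof -
    obtain f where "f \<in> E" "constant_term f \<noteq> 0" using S(3) E(3) by auto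
    then have "f \<noteq> 0" by auto
    with \<open>f \<in> E\<close> show ?thesis by blast
  qed
  ultimately have "1 \<in> N"
    using N E(1,2) F(1,2) unfolding R.integral_t_ideals_iff by (meson Un_least finite_UnI subsetD)
  with NI(2) show False by simp
qed

text \<open>The argument common to both families. From \<open>D\<close> to \<open>R\<close>: an
  ideal below \<open>extension I\<close> lies below the extension of a maximal \<open>M\<close>
  above \<open>I\<close>, and \<open>P\<close> holds for \<open>M\<close> because no other member of
  the family lies above it. From \<open>R\<close> to \<open>D\<close>: an ideal with
  \<open>P\<close> above \<open>extension M\<close> is the extension of its trace on
  \<open>D\<close>, and maximality identifies this trace with \<open>M\<close>.\<close>

lemma meets_iff:
  assumes S: "\<And>A. S A \<subseteq> integral_ideals A"
    and max: "\<And>I. I \<in> S D \<Longrightarrow> \<exists>M. maximal_in (S D) M \<and> I \<subseteq> M"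
    and ext: "\<And>M. M \<in> integral_ideals D \<Longrightarrow> extension M \<in> S R \<longleftrightarrow> M \<in> S D"
    and cover: "\<And>N. N \<in> S R \<Longrightarrow> (\<exists>I\<in>S D. N \<subseteq> extension I) \<or> (\<exists>\<gamma>\<in>Gamma S R P. N \<subseteq> \<gamma>)"
    and P: "\<And>M. maximal_in (S D) M \<Longrightarrow> P (ring_on D) M \<longleftrightarrow> P (ring_on R) (extension M)"
  shows "meets S D P \<longleftrightarrow> meets S R P"
proof
  assume D: "meets S D P"
  show "meets S R P"
    unfolding meets_def
  proof
    fix N assume "N \<in> S R"
    from cover[OF this] show "\<exists>\<gamma>\<in>Gamma S R P. N \<subseteq> \<gamma>"
    proof
      assume "\<exists>I\<in>S D. N \<subseteq> extension I"
      then obtain I where I: "I \<in> S D" "N \<subseteq> extension I" by blast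
      from max[OF I(1)] obtain M where M: "maximal_in (S D) M" "I \<subseteq> M" by blast
      then have MS: "M \<in> S D" by (simp add: maximal_in_def)
      with D obtain \<gamma> where "\<gamma> \<in> Gamma S D P" "M \<subseteq> \<gamma>" by (auto simp: meets_def)
      with M(1) have "P (ring_on D) M" by (auto simp: maximal_in_def Gamma_def)
      then have "P (ring_on R) (extension M)" using P M(1) by blast
      moreover have "extension M \<in> S R" using ext S MS by blast
      moreover have "N \<subseteq> extension M" using I(2) M(2) by (auto simp: extension_def)
      ultimately show ?thesis by (auto simp: Gamma_def)
    qed
  qed
next
  assume R: "meets S R P"
  show "meets S D P"
    unfolding meets_def
  proof
    fix I assume "I \<in> S D"
    from max[OF this] obtain M where M: "maximal_in (S D) M" "I \<subseteq> M" by blast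
    then have MS: "M \<in> S D" by (simp add: maximal_in_def)
    then have "M \<in> integral_ideals D" using S by blast
    then have MI: "ideal M (ring_on D)" "M \<subseteq> D" "M \<noteq> {0}" "M \<in> integral_ideals D"
      by (auto simp: integral_ideals_def ideal_iff)
    have "extension M \<in> S R" using ext MI MS by blast
    with R obtain N where N: "N \<in> S R" "P (ring_on R) N" "extension M \<subseteq> N"
      by (auto simp: meets_def Gamma_def)
    have "N \<in> integral_ideals R" using N(1) S by blast
    then have NI: "ideal N (ring_on R)" "1 \<notin> N"
      using R.proper_iff by (auto simp: integral_ideals_def)
    have eq: "N = extension (N \<inter> D)" using eq_extension[OF NI(1) MI(1) N(3)] .
    have le: "M \<subseteq> N \<inter> D" using extension_inter_D[OF MI(2)] N(3) by blast
    have "N \<inter> D \<in> integral_ideals D"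
      using ideal_inter_D[OF NI(1)] NI(2) one_mem le MI(1,3) unfolding integral_ideals_def ideal_iff
      by blast
    moreover have "extension (N \<inter> D) \<in> S R" using N(1) eq by simp
    ultimately have "N \<inter> D \<in> S D" using ext by blast
    then have "N \<inter> D = M" using M(1) le by (auto simp: maximal_in_def)
    then have "P (ring_on D) M" using P[OF M(1)] N(2) eq by simp
    then show "\<exists>\<gamma>\<in>Gamma S D P. I \<subseteq> \<gamma>" using MS M(2) by (auto simp: Gamma_def)
  qed
qed

lemma subset_extension: "ideal N (ring_on R) \<Longrightarrow> constant_term ` N \<subseteq> I \<Longrightarrow> N \<subseteq> extension I"
  unfolding R.ideal_iff by (auto simp: extension_def)

text \<open>If 1 is not a constant term of \<open>N\<close>, the constant terms lie in a member of
  I(D). Otherwise spanning would put 1 into \<open>N\<close>, so \<open>dich\<close> must supply an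
  ideal with \<open>P\<close>.\<close>

lemma meets_integral_ideals_iff:
  assumes dich: "\<And>N f. N \<in> integral_ideals R \<Longrightarrow> f \<in> N \<Longrightarrow> constant_term f \<noteq> 0 \<Longrightarrow>
      spans N \<or> (\<exists>\<gamma>\<in>Gamma integral_ideals R P. N \<subseteq> \<gamma>)"
    and P: "\<And>M. maximalideal M (ring_on D) \<Longrightarrow> P (ring_on D) M \<longleftrightarrow> P (ring_on R) (extension M)"
  shows "meets integral_ideals D P \<longleftrightarrow> meets integral_ideals R P"
proof (rule meets_iff)
  show "extension M \<in> integral_ideals R \<longleftrightarrow> M \<in> integral_ideals D" if "M \<in> integral_ideals D" for M
    using that extension_integral_ideal by blast
  fix N assume N: "N \<in> integral_ideals R"
  then have NI: "ideal N (ring_on R)" "1 \<notin> N"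
    using R.proper_iff by (auto simp: integral_ideals_def)
  define I where "I = constant_term ` N"
  have I: "ideal I (ring_on D)" unfolding I_def using NI(1) by (rule ideal_constant_terms)
  show "(\<exists>I\<in>integral_ideals D. N \<subseteq> extension I) \<or> (\<exists>\<gamma>\<in>Gamma integral_ideals R P. N \<subseteq> \<gamma>)"
  proof (cases "1 \<in> I")
    case False
    obtain I' where "I' \<in> integral_ideals D" "I \<subseteq> I'"
    \<comment> \<open>The zero ideal is not in I(D), but every member of I(D) contains it.\<close>
    proof (cases "I = {0}")
      case True
      obtain I' where "I' \<in> integral_t_ideals D" using integral_t_ideals_nonempty by blast
      then have "I' \<in> integral_ideals D" "0 \<in> I'"
        by (auto simp: integral_t_ideals_def integral_ideals_def ideal_iff)
      with True that show ?thesis by blast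
    next
      case I0: False
      have "I \<in> integral_ideals D"
        using I I0 False proper_iff[OF I] by (auto simp: integral_ideals_def)
      with that show ?thesis by blast
    qed
    with subset_extension[OF NI(1)] show ?thesis by (auto simp: I_def)
  next
    case True
    then obtain f where f: "f \<in> N" "constant_term f = 1" by (force simp: I_def)
    then show ?thesis
      using dich[OF N f(1)] one_mem_if_spans[OF NI(1) _ f] NI(2) by auto
  qed
qed (use exists_maximal_integral_ideal P maximalideal_if_maximal_in in auto)

text \<open>If the t-closure of the ideal of constant terms is proper, it is a t-ideal whose
  extension contains \<open>N\<close>. Otherwise \<open>one_notin_t_closure_if_spans\<close>
  excludes the first alternative of \<open>dich\<close>.\<close>

lemma meets_integral_t_ideals_iff:
  assumes dich: "\<And>N f. N \<in> integral_t_ideals R \<Longrightarrow> f \<in> N \<Longrightarrow> constant_term f \<noteq> 0 \<Longrightarrow>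
      spans N \<or> (\<exists>\<gamma>\<in>Gamma integral_t_ideals R P. N \<subseteq> \<gamma>)"
    and P: "\<And>M. maximal_t_ideal D M \<Longrightarrow> P (ring_on D) M \<longleftrightarrow> P (ring_on R) (extension M)"
  shows "meets integral_t_ideals D P \<longleftrightarrow> meets integral_t_ideals R P"
proof (rule meets_iff)
  fix N assume N: "N \<in> integral_t_ideals R"
  then have NI: "ideal N (ring_on R)" "1 \<notin> N"
    using R.proper_iff by (auto simp: integral_t_ideals_def integral_ideals_def)
  define I where "I = constant_term ` N"
  have I: "ideal I (ring_on D)" unfolding I_def using NI(1) by (rule ideal_constant_terms)
  show "(\<exists>I\<in>integral_t_ideals D. N \<subseteq> extension I) \<or> (\<exists>\<gamma>\<in>Gamma integral_t_ideals R P. N \<subseteq> \<gamma>)"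
  proof (cases "I = {0}")
    case True
    obtain I' where I': "I' \<in> integral_t_ideals D" using integral_t_ideals_nonempty by blast
    then have "0 \<in> I'" by (auto simp: integral_t_ideals_def integral_ideals_def ideal_iff)
    then show ?thesis using subset_extension[OF NI(1), of I'] True I' by (auto simp: I_def)
  next
    case False
    show ?thesis
    proof (cases "1 \<in> t_closure D I")
      case True
      \<comment> \<open>That 1 lies in the t-closure of \<open>I\<close> does not put 1 into
        \<open>I\<close>. For this reason \<open>dich\<close> asks for a nonzero constant term
        rather than for constant term 1.\<close>
      from False I obtain x where "x \<in> I" "x \<noteq> 0" by (auto simp: ideal_iff)
      then obtain f where "f \<in> N" "constant_term f \<noteq> 0" by (auto simp: I_def)
      then show ?thesis
        using dich[OF N] one_notin_t_closure_if_spans[OF N] True by (auto simp: I_def)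
    next
      case nt: False
      have "N \<subseteq> extension (t_closure D I)"
        using subset_extension[OF NI(1)] subset_t_closure[OF I False] by (auto simp: I_def)
      then show ?thesis using t_closure_integral_t_ideal[OF I False nt] by blast
    qed
  qed
qed (use exists_maximal_integral_t_ideal P extension_integral_t_ideal_iff
    in \<open>auto simp: integral_t_ideals_def maximal_in_def maximal_t_ideal_def\<close>)

end

section \<open>The hypotheses on D, and L[X] and L[[X]] as choices of B\<close>

lemma (in field_subring) exists_nonunit:
  assumes "\<not> field (ring_on A)" shows "\<exists>a\<in>A. a \<noteq> 0 \<and> 1 / a \<notin> A"
proof (rule ccontr)
  assume neg: "\<not> (\<exists>a\<in>A. a \<noteq> 0 \<and> 1 / a \<notin> A)"
  interpret domain "ring_on A" by (rule domain_ring_on)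
  have "\<exists>b\<in>A. a * b = 1" if "a \<in> A" "a \<noteq> 0" for a
    using that neg by (intro bexI[of _ "1 / a"]) auto
  then have "field (ring_on A)"
    by (intro cring_fieldI2) (auto simp: ring_on_def)
  with assms show False ..
qed

lemma constant_extensionI:
  fixes D :: "'l::field fls set"
  assumes "domain (ring_on D)" "\<not> field (ring_on D)" "quotient_field D \<subseteq> constants"
    and "field_subring B" "B \<subseteq> range fps_to_fls" "constants \<subseteq> B"
  shows "constant_extension D B"
  using assms domain_ring_on_iff[of D] field_subring.exists_nonunit[of D]
  by (auto simp: constant_extension_def constant_extension_axioms_def)

lemma field_subring_fps: "field_subring (range fps_to_fls :: 'l::field fls set)"
proof
  fix x y :: "'l fls" assume "x \<in> range fps_to_fls" "y \<in> range fps_to_fls"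
  then obtain f g where "x = fps_to_fls f" "y = fps_to_fls g" by blast
  then have "x + y = fps_to_fls (f + g)" "x * y = fps_to_fls (f * g)"
    by (simp_all add: fls_times_fps_to_fls)
  then show "x + y \<in> range fps_to_fls" "x * y \<in> range fps_to_fls" by blast+
next
  fix x :: "'l fls" assume "x \<in> range fps_to_fls"
  then obtain f where "x = fps_to_fls f" by blast
  then have "- x = fps_to_fls (- f)" by simp
  then show "- x \<in> range fps_to_fls" by blast
qed (metis fps_zero_to_fls rangeI, metis fps_one_to_fls rangeI)

definition poly_to_fls :: "'l::field poly \<Rightarrow> 'l fls" where
  "poly_to_fls p = fps_to_fls (fps_of_poly p)"

lemma poly_to_fls_0 [simp]: "poly_to_fls 0 = 0"
  and poly_to_fls_1 [simp]: "poly_to_fls 1 = 1"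
  and poly_to_fls_add: "poly_to_fls (p + q) = poly_to_fls p + poly_to_fls q"
  and poly_to_fls_uminus: "poly_to_fls (- p) = - poly_to_fls p"
  and poly_to_fls_mult: "poly_to_fls (p * q) = poly_to_fls p * poly_to_fls q"
  and poly_to_fls_eq_iff [simp]: "poly_to_fls p = poly_to_fls q \<longleftrightarrow> p = q"
  and constant_term_poly_to_fls: "constant_term (poly_to_fls p) = fls_const (coeff p 0)"
  by (simp_all add: poly_to_fls_def constant_term_def fps_of_poly_add fps_of_poly_uminus
      fps_of_poly_mult fls_times_fps_to_fls fps_of_poly_eq_iff)

lemma poly_to_fls_sum: "poly_to_fls (sum f S) = (\<Sum>s\<in>S. poly_to_fls (f s))"
  by (induction S rule: infinite_finite_induct) (auto simp: poly_to_fls_add)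

lemma field_subring_poly: "field_subring (range poly_to_fls :: 'l::field fls set)"
proof
  fix x y :: "'l fls" assume "x \<in> range poly_to_fls" "y \<in> range poly_to_fls"
  then obtain f g where "x = poly_to_fls f" "y = poly_to_fls g" by blast
  then have "x + y = poly_to_fls (f + g)" "x * y = poly_to_fls (f * g)"
    by (simp_all add: poly_to_fls_add poly_to_fls_mult)
  then show "x + y \<in> range poly_to_fls" "x * y \<in> range poly_to_fls" by blast+
next
  fix x :: "'l fls" assume "x \<in> range poly_to_fls"
  then obtain f where "x = poly_to_fls f" by blast
  then have "- x = poly_to_fls (- f)" by (simp add: poly_to_fls_uminus)
  then show "- x \<in> range poly_to_fls" by blast
qed (metis poly_to_fls_0 rangeI, metis poly_to_fls_1 rangeI)

lemma constants_subset_poly: "constants \<subseteq> range poly_to_fls"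
proof
  fix c :: "'l::field fls" assume "c \<in> constants"
  then obtain a where "c = fls_const a" by (auto simp: constants_def)
  then have "c = poly_to_fls [:a:]" by (simp add: poly_to_fls_def fps_of_poly_const)
  then show "c \<in> range poly_to_fls" by blast
qed

section \<open>Ideals of R that contain an element with nonzero constant term\<close>

context constant_extension
begin

text \<open>A power series with nonzero constant term is a unit, so \<open>f\<close> alone gives the
  relation.\<close>

lemma spans_if_power_series:
  assumes B: "B = range fps_to_fls" and N: "ideal N (ring_on R)"
    and f: "f \<in> N" "constant_term f \<noteq> 0"
  shows "spans N"
proof -
  have "f \<in> B" using f(1) N R_subset_B by (auto simp: R.ideal_iff)
  then obtain g where g: "f = fps_to_fls g" using B by blast
  then have "inverse g * g = 1"
    using f(2) by (intro inverse_mult_eq_1) (simp add: constant_term_def)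
  then have "fps_to_fls (inverse g) * f = 1" by (simp add: g flip: fls_times_fps_to_fls)
  then show ?thesis
    unfolding spans_def using f(1) B
    by (intro exI[of _ "{f}"] exI[of _ "\<lambda>_. fps_to_fls (inverse g)"]) auto
qed

text \<open>A generator of $N L[X]$ with constant term 1 either is 1 or generates a proper principal
  ideal of $R$ that contains $N$.\<close>

lemma spans_or_principal:
  assumes B: "B = range poly_to_fls" and N: "ideal N (ring_on R)"
    and f: "f \<in> N" "constant_term f \<noteq> 0"
  shows "spans N \<or> (\<exists>g\<in>R. g \<noteq> 0 \<and> 1 / g \<notin> R \<and> N \<subseteq> (*) g ` R)"
proof -
  \<comment> \<open>With polynomials as a module over themselves, the span of a set is the ideal it
    generates; \<open>J\<close> below is N L[X].\<close>
  interpret poly: module "(*) :: 'l poly \<Rightarrow> 'l poly \<Rightarrow> 'l poly"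
    by unfold_locales (auto simp: algebra_simps)
  define J where "J = poly.span {p. poly_to_fls p \<in> N}"
  have memB: "poly_to_fls p \<in> B" for p using B by blast
  have NB: "N \<subseteq> B" using N R_subset_B by (auto simp: R.ideal_iff)
  then obtain f' where f': "f = poly_to_fls f'" using f(1) B by blast
  have f'J: "f' \<in> J" unfolding J_def by (rule poly.span_base) (use f f' in simp)
  have f'0: "coeff f' 0 \<noteq> 0" using f(2) f' by (simp add: constant_term_poly_to_fls)
  have "f' \<in> J \<and> f' \<noteq> 0" using f'J f'0 by auto
  \<comment> \<open>A nonzero member of least degree generates \<open>J\<close>: division by it
    leaves a remainder in \<open>J\<close> of smaller degree, hence 0.\<close>
  from ex_has_least_nat[of "\<lambda>p. p \<in> J \<and> p \<noteq> 0", OF this, of degree]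
  obtain g where g: "g \<in> J" "g \<noteq> 0" and least: "\<And>p. p \<in> J \<Longrightarrow> p \<noteq> 0 \<Longrightarrow> degree g \<le> degree p"
    by blast
  have dvd: "g dvd p" if "p \<in> J" for p
  proof -
    have "p - p div g * g \<in> J"
      using that g(1) unfolding J_def by (intro poly.span_diff poly.span_scale)
    then have "p mod g \<in> J" by (simp add: minus_div_mult_eq_mod)
    then have "p mod g = 0" using least degree_mod_less[OF g(2), of p] by force
    then show ?thesis by (simp add: dvd_eq_mod_eq_0)
  qed
  \<comment> \<open>A product has constant term 0 as soon as one factor does, so \<open>g\<close>, a
    divisor of \<open>f'\<close>, has nonzero constant term.\<close>
  from dvd[OF f'J] f'0 have g0: "coeff g 0 \<noteq> 0" by (auto simp: coeff_mult)
  define g1 where "g1 = [:1 / coeff g 0:] * g"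
  have g1: "g1 \<in> J" unfolding g1_def J_def by (rule poly.span_scale) (use g in \<open>simp add: J_def\<close>)
  have c1: "coeff g1 0 = 1" using g0 by (simp add: g1_def)
  then have "g1 \<noteq> 0" by auto
  have dvd1: "g1 dvd p" if "p \<in> J" for p
    using dvd[OF that] g0 by (simp add: g1_def smult_dvd_iff)
  show ?thesis
  proof (cases "degree g1 = 0")
    case True
    then have "g1 = 1" using c1 by (metis degree_0_id one_pCons)
    with g1 have "1 \<in> J" by simp
    then obtain t r where t: "finite t" "t \<subseteq> {p. poly_to_fls p \<in> N}" "1 = (\<Sum>a\<in>t. r a * a)"
      unfolding J_def poly.span_explicit mem_Collect_eq by blast
    have inj: "inj poly_to_fls" by (simp add: inj_def)
    \<comment> \<open>\<open>spans\<close> indexes coefficients by elements of \<open>N\<close>, the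
      relation in L[X] by polynomials; inverting the injective embedding passes between the
      two.\<close>
    define h where "h u = poly_to_fls (r (inv_into UNIV poly_to_fls u))" for u
    have "(\<Sum>u\<in>poly_to_fls ` t. h u * u) = (\<Sum>a\<in>t. poly_to_fls (r a * a))"
      by (subst sum.reindex[OF inj_on_subset[OF inj]])
        (auto simp: h_def inv_f_f[OF inj] poly_to_fls_mult)
    also have "\<dots> = 1" by (simp add: t(3)[symmetric] flip: poly_to_fls_sum)
    finally have "spans N"
      unfolding spans_def using t(1,2) B by (intro exI[of _ "poly_to_fls ` t"] exI[of _ h]) (auto simp: h_def)
    then show ?thesis ..
  next
    case False
    have "poly_to_fls g1 \<in> R"
      using c1 memB one_mem by (simp add: extension_def constant_term_poly_to_fls)
    moreover have "poly_to_fls g1 \<noteq> 0" using \<open>g1 \<noteq> 0\<close> poly_to_fls_eq_iff[of g1 0] by simp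
    \<comment> \<open>An inverse in \<open>R\<close> would be a polynomial and make
      \<open>g1\<close> a unit of L[X], against its positive degree.\<close>
    moreover have "1 / poly_to_fls g1 \<notin> R"
    proof
      assume "1 / poly_to_fls g1 \<in> R"
      then obtain q where "1 / poly_to_fls g1 = poly_to_fls q" using R_subset_B B by auto
      then have "poly_to_fls (g1 * q) = poly_to_fls 1"
        using \<open>poly_to_fls g1 \<noteq> 0\<close> by (simp add: poly_to_fls_mult field_simps)
      then have "g1 dvd 1" by (metis dvd_triv_left poly_to_fls_eq_iff)
      with False show False by (simp add: is_unit_iff_degree \<open>g1 \<noteq> 0\<close>)
    qed
    moreover have "N \<subseteq> (*) (poly_to_fls g1) ` R"
    proof
      fix u assume u: "u \<in> N"
      then obtain p where p: "u = poly_to_fls p" using NB B by blast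
      have "p \<in> J" unfolding J_def by (rule poly.span_base) (use u p in simp)
      from dvd1[OF this] obtain k where k: "p = g1 * k" by blast
      \<comment> \<open>The normalization of \<open>g1\<close> pays off here: the cofactor
        \<open>k\<close> inherits the constant term of \<open>p\<close>, which is in
        \<open>D\<close>, so \<open>k\<close> lies in \<open>R\<close> and not merely in
        L[X].\<close>
      have "coeff p 0 = coeff k 0" using c1 by (simp add: k coeff_mult)
      moreover have "constant_term u \<in> D" using u N unfolding R.ideal_iff by (auto simp: extension_def)
      ultimately have "poly_to_fls k \<in> R"
        using memB p by (simp add: extension_def constant_term_poly_to_fls)
      then show "u \<in> (*) (poly_to_fls g1) ` R" by (auto simp: p k poly_to_fls_mult)
    qed
    ultimately show ?thesis by blast
  qed
qed

text \<open>The proper principal ideal gR found above is a t-ideal, and it has \<open>P\<close>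
  since \<open>P\<close> respects principals.\<close>

lemma spans_or_Gamma:
  assumes B: "B = range poly_to_fls" and N: "ideal N (ring_on R)"
    and f: "f \<in> N" "constant_term f \<noteq> 0" and P: "respects_principals P"
  shows "spans N \<or> (\<exists>\<gamma>\<in>Gamma integral_t_ideals R P. N \<subseteq> \<gamma>)"
proof -
  have "(*) g ` R \<in> Gamma integral_t_ideals R P" if g: "g \<in> R" "g \<noteq> 0" "1 / g \<notin> R" for g
  proof -
    have t: "(*) g ` R \<in> integral_t_ideals R" using R.principal_integral_t_ideal g by blast
    then have "(*) g ` R \<noteq> {\<zero>\<^bsub>ring_on R\<^esub>}"
      by (simp add: integral_t_ideals_def integral_ideals_def ring_on_def)
    then have "P (ring_on R) ((*) g ` R)"
      using P R.domain_ring_on R.principalideal_image[OF g(1)] by (simp add: respects_principals_def)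
    with t show ?thesis by (simp add: Gamma_def)
  qed
  then show ?thesis using spans_or_principal[OF B N f] by blast
qed

end

section \<open>The four equivalences, obtained from the two choices of B\<close>

theorem theorem2p4:
  fixes D :: "'l::field fls set"
    and P :: "'l fls ring \<Rightarrow> 'l fls set \<Rightarrow> bool"
  assumes "domain (ring_on D)"
    and "\<not> field (ring_on D)"
    and "quotient_field D \<subseteq> constants"
  shows
    "(respects_principals P \<longrightarrow>
        ((\<forall>M. maximalideal M (ring_on D) \<longrightarrow>
            (P (ring_on D) M \<longleftrightarrow> P (ring_on (plus_X_poly D)) (plus_X_poly M)))
          \<longrightarrow> (meets integral_ideals D P \<longleftrightarrow> meets integral_ideals (plus_X_poly D) P))
      \<and> ((\<forall>M. maximal_t_ideal D M \<longrightarrow>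
            (P (ring_on D) M \<longleftrightarrow> P (ring_on (plus_X_poly D)) (plus_X_poly M)))
          \<longrightarrow> (meets integral_t_ideals D P \<longleftrightarrow> meets integral_t_ideals (plus_X_poly D) P)))
   \<and> ((\<forall>M. maximalideal M (ring_on D) \<longrightarrow>
          (P (ring_on D) M \<longleftrightarrow> P (ring_on (plus_X_fps D)) (plus_X_fps M)))
        \<longrightarrow> (meets integral_ideals D P \<longleftrightarrow> meets integral_ideals (plus_X_fps D) P))
   \<and> ((\<forall>M. maximal_t_ideal D M \<longrightarrow>
          (P (ring_on D) M \<longleftrightarrow> P (ring_on (plus_X_fps D)) (plus_X_fps M)))
        \<longrightarrow> (meets integral_t_ideals D P \<longleftrightarrow> meets integral_t_ideals (plus_X_fps D) P))"
proof -
  interpret poly: constant_extension D "range poly_to_fls"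
    by (rule constant_extensionI[OF assms field_subring_poly _ constants_subset_poly])
      (auto simp: poly_to_fls_def)
  have "constants \<subseteq> (range fps_to_fls :: 'l fls set)"
    using constants_subset_poly by (auto simp: poly_to_fls_def)
  then interpret fps: constant_extension D "range fps_to_fls"
    by (rule constant_extensionI[OF assms field_subring_fps order_refl])
  have eq_poly: "plus_X_poly M = poly.extension M" for M
    by (auto simp: plus_X_poly_def poly.extension_def constant_term_poly_to_fls poly_0_coeff_0
        simp flip: poly_to_fls_def)
  have eq_fps: "plus_X_fps M = fps.extension M" for M
    by (auto simp: plus_X_fps_def fps.extension_def constant_term_def)
  have poly: "poly.spans N \<or> (\<exists>\<gamma>\<in>Gamma integral_t_ideals poly.R P. N \<subseteq> \<gamma>)"
    if "respects_principals P" "N \<in> integral_ideals poly.R" "f \<in> N" "constant_term f \<noteq> 0" for N f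
    using poly.spans_or_Gamma[OF refl _ that(3,4,1)] that(2) by (simp add: integral_ideals_def)
  \<comment> \<open>Proper t-ideals belong to I(R), so the ideal found for the t-case serves the
    family of all ideals as well.\<close>
  have poly': "poly.spans N \<or> (\<exists>\<gamma>\<in>Gamma integral_ideals poly.R P. N \<subseteq> \<gamma>)"
    if "respects_principals P" "N \<in> integral_ideals poly.R" "f \<in> N" "constant_term f \<noteq> 0" for N f
    using poly[OF that] by (auto simp: Gamma_def integral_t_ideals_def)
  \<comment> \<open>For L[[X]] the dichotomy always ends in its first alternative.\<close>
  have fps: "fps.spans N"
    if "N \<in> integral_ideals fps.R" "f \<in> N" "constant_term f \<noteq> 0" for N f
    using fps.spans_if_power_series[OF refl _ that(2,3)] that(1) by (simp add: integral_ideals_def)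
  have t: "N \<in> integral_ideals A" if "N \<in> integral_t_ideals A" for N A :: "'l fls set"
    using that by (simp add: integral_t_ideals_def)
  show ?thesis
    unfolding eq_poly eq_fps
  proof (intro conjI impI)
    assume P: "respects_principals P"
    show "meets integral_ideals D P \<longleftrightarrow> meets integral_ideals poly.R P"
      if "\<forall>M. maximalideal M (ring_on D) \<longrightarrow>
            (P (ring_on D) M \<longleftrightarrow> P (ring_on poly.R) (poly.extension M))"
      using poly.meets_integral_ideals_iff[of P] poly'[OF P] that by blast
    show "meets integral_t_ideals D P \<longleftrightarrow> meets integral_t_ideals poly.R P"
      if "\<forall>M. maximal_t_ideal D M \<longrightarrow>
            (P (ring_on D) M \<longleftrightarrow> P (ring_on poly.R) (poly.extension M))"
      using poly.meets_integral_t_ideals_iff[of P] poly[OF P t] that by blast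
  next
    show "meets integral_ideals D P \<longleftrightarrow> meets integral_ideals fps.R P"
      if "\<forall>M. maximalideal M (ring_on D) \<longrightarrow>
            (P (ring_on D) M \<longleftrightarrow> P (ring_on fps.R) (fps.extension M))"
      using fps.meets_integral_ideals_iff[of P] fps that by blast
    show "meets integral_t_ideals D P \<longleftrightarrow> meets integral_t_ideals fps.R P"
      if "\<forall>M. maximal_t_ideal D M \<longrightarrow>
            (P (ring_on D) M \<longleftrightarrow> P (ring_on fps.R) (fps.extension M))"
      using fps.meets_integral_t_ideals_iff[of P] fps[OF t] that by blast
  qed
qed

end
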